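(* Let $G$ be a matrix weighted connected graph of order $n$ and let $L=L(G)$. Then $$Kf(G)=n\sum_{i\in V(G)}L_{ii}^+,$$ where $L_{ii}^+$ denotes the $i$-th diagonal block of the Moore-Penrose inverse $L^+$ of $L$.
   Context: A matrix weighted graph is a finite, simple, undirected, connected graph in which each edge $ij$ is assigned a weight $W_{ij}=W_{ji}$ that is a (real symmetric) positive definite matrix of a given order $k$. For a matrix weighted graph $G$ with vertices $1,\dots,n$, the Laplacian $L=L(G)$ is the $nk\times nk$ block matrix with $k\times k$ blocks $L_{ii}=\sum_{j\sim i}W_{ij}^{-1}$, $L_{ij}=-W_{ij}^{-1}$ if $i\neq j$ and $i\sim j$, and $L_{ij}=0$ if $i\ne j$ and $i\nsim j$. A $(1)$-inverse of a matrix $M$ is a matrix $C$ with $MCM=M$. The resistance matrix $R(G)$ is the $nk\times nk$ block matrix with blocks $R_{ij}=L^{(1)}_{ii}+L^{(1)}_{jj}-L^{(1)}_{ij}-L^{(1)}_{ji}$, where $L^{(1)}$ is any $(1)$-inverse of $L$ (the result does not depend on the choice; $L^+$ is one choice). The Kirchhoff index of a connected matrix weighted graph is the $k\times k$ matrix $Kf(G)=\frac12\sum_{i\in V(G)}\sum_{j\in V(G)}R_{ij}$. *)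

theory Defs
  imports "HOL-Analysis.Analysis"
begin

text \<open>
  The vertex set of a graph is the finite type \<^typ>\<open>'v\<close>, so the order of the graph is
  \<open>CARD('v)\<close>; weights are square matrices indexed by the finite type \<^typ>\<open>'k\<close>.
  Block matrices with blocks indexed by \<^typ>\<open>'v\<close> are matrices indexed by \<^typ>\<open>'v \<times> 'k\<close>.
\<close>

definition pos_def :: "real^'k^'k \<Rightarrow> bool" where
  "pos_def A \<longleftrightarrow> transpose A = A \<and> (\<forall>x. x \<noteq> 0 \<longrightarrow> 0 < x \<bullet> (A *v x))"

text \<open>
  \<open>E\<close> is the adjacency relation. The weight function \<open>W\<close> is constrained on edges only; its
  values on non-adjacent pairs are irrelevant.
\<close>

locale matrix_weighted_graph =
  fixes E :: "'v::finite \<Rightarrow> 'v \<Rightarrow> bool"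
    and W :: "'v \<Rightarrow> 'v \<Rightarrow> real^'k^'k"
  assumes adj_sym: "E i j \<Longrightarrow> E j i"
    and adj_irrefl: "\<not> E i i"
    and connected: "rtranclp E i j"
    and weight_sym: "E i j \<Longrightarrow> W i j = W j i"
    and weight_pos_def: "E i j \<Longrightarrow> pos_def (W i j)"

definition mat_of_blocks :: "('v::finite \<Rightarrow> 'v \<Rightarrow> real^'k^'k) \<Rightarrow> real^('v \<times> 'k)^('v \<times> 'k)" where
  "mat_of_blocks B = (\<chi> p q. B (fst p) (fst q) $ snd p $ snd q)"

definition mat_block :: "real^('v::finite \<times> 'k)^('v \<times> 'k) \<Rightarrow> 'v \<Rightarrow> 'v \<Rightarrow> real^'k^'k" where
  "mat_block M i j = (\<chi> a b. M $ (i, a) $ (j, b))"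

definition laplacian ::
  "('v::finite \<Rightarrow> 'v \<Rightarrow> bool) \<Rightarrow> ('v \<Rightarrow> 'v \<Rightarrow> real^'k^'k) \<Rightarrow> real^('v \<times> 'k)^('v \<times> 'k)" where
  "laplacian E W = mat_of_blocks (\<lambda>i j.
     if i = j then \<Sum>l | E i l. matrix_inv (W i l)
     else if E i j then - matrix_inv (W i j)
     else 0)"

definition one_inverse :: "real^'m^'m \<Rightarrow> real^'m^'m \<Rightarrow> bool" where
  "one_inverse M C \<longleftrightarrow> M ** C ** M = M"

text \<open>The Moore-Penrose inverse is the unique solution of the four Penrose equations.\<close>

definition moore_penrose :: "real^'m^'m \<Rightarrow> real^'m^'m" where
  "moore_penrose M = (THE X.
     M ** X ** M = M \<and> X ** M ** X = X \<and>
     transpose (M ** X) = M ** X \<and> transpose (X ** M) = X ** M)"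

text \<open>
  The definite description expresses that all (1)-inverses \<open>C\<close> of the Laplacian yield one and
  the same matrix.
\<close>

definition resistance_matrix ::
  "('v::finite \<Rightarrow> 'v \<Rightarrow> bool) \<Rightarrow> ('v \<Rightarrow> 'v \<Rightarrow> real^'k^'k) \<Rightarrow> real^('v \<times> 'k)^('v \<times> 'k)" where
  "resistance_matrix E W = (THE R. \<exists>C. one_inverse (laplacian E W) C \<and>
     R = mat_of_blocks (\<lambda>i j.
       mat_block C i i + mat_block C j j - mat_block C i j - mat_block C j i))"

definition kirchhoff_index ::
  "('v::finite \<Rightarrow> 'v \<Rightarrow> bool) \<Rightarrow> ('v \<Rightarrow> 'v \<Rightarrow> real^'k^'k) \<Rightarrow> real^'k^'k" where
  "kirchhoff_index E W =
     (1/2) *\<^sub>R (\<Sum>i\<in>UNIV. \<Sum>j\<in>UNIV. mat_block (resistance_matrix E W) i j)"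

end

theory Submission
  imports Defs
begin

text \<open>
  Let \<open>P\<close> be the orthogonal projection onto the block-constant vectors. Positive definiteness
  of the weights and connectedness show that the kernel of \<open>L\<close> is the range of \<open>P\<close>, and
  \<open>L P = P L = 0\<close>. So \<open>L + P\<close> is invertible and \<open>X = (L + P)\<^sup>-\<^sup>1 - P\<close> satisfies
  \<open>L X = X L = 1 - P\<close>, whence \<open>X\<close> is the Moore-Penrose inverse. If \<open>C\<close> is another
  (1)-inverse, \<open>D = C - X\<close> satisfies \<open>(1 - P) D (1 - P) = X L D L X = 0\<close>, so \<open>D\<close> is a sum of a
  matrix with constant block columns and one with constant block rows, and does not contribute
  to \<open>R\<close>. Finally \<open>P X = 0\<close> says that the off-diagonal terms of \<open>R\<close> sum to zero.
\<close>

section \<open>Positive definite matrices\<close>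

lemma pos_def_invertible:
  fixes A :: "real^'k^'k"
  assumes "pos_def A"
  shows "invertible A"
proof -
  have "\<forall>x. A *v x = 0 \<longrightarrow> x = 0"
    using assms unfolding pos_def_def by (metis inner_zero_right less_irrefl)
  then show ?thesis
    by (simp add: invertible_left_inverse matrix_left_invertible_ker)
qed

lemma matrix_inv_mult:
  fixes A :: "real^'k^'k"
  assumes "invertible A"
  shows "A ** matrix_inv A = mat 1" "matrix_inv A ** A = mat 1"
  using someI_ex[OF assms[unfolded invertible_def]] unfolding matrix_inv_def by auto

text \<open>Substituting \<open>x = A y\<close> turns the form of the inverse at \<open>x\<close>
  into the form of \<open>A\<close> at \<open>y\<close>. The Laplacian is built from inverse
  weights, so this is where their definiteness enters.\<close>

lemma pos_def_matrix_inv_inner: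
  fixes A :: "real^'k^'k"
  assumes "pos_def A" "x \<noteq> 0"
  shows "0 < x \<bullet> (matrix_inv A *v x)"
proof -
  let ?y = "matrix_inv A *v x"
  have x: "A *v ?y = x"
    by (simp add: matrix_vector_mul_assoc matrix_inv_mult pos_def_invertible assms)
  with assms have "?y \<noteq> 0" by auto
  with assms have "0 < ?y \<bullet> (A *v ?y)" unfolding pos_def_def by blast
  with x show ?thesis by (simp add: inner_commute)
qed

section \<open>The Moore-Penrose inverse\<close>

lemma matrix_add_rdistrib:
  fixes A B :: "'a::ring_1^'m^'n"
  shows "(A + B) ** C = A ** C + B ** C"
  by (simp add: vec_eq_iff matrix_matrix_mult_def sum.distrib algebra_simps)

lemma matrix_diff_ldistrib:
  fixes A :: "'a::ring_1^'m^'n"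
  shows "A ** (B - C) = A ** B - A ** C"
  by (simp add: vec_eq_iff matrix_matrix_mult_def sum_subtractf algebra_simps)

lemma matrix_diff_rdistrib:
  fixes A B :: "'a::ring_1^'m^'n"
  shows "(A - B) ** C = A ** C - B ** C"
  by (simp add: vec_eq_iff matrix_matrix_mult_def sum_subtractf algebra_simps)

lemmas matrix_diff_distribs = matrix_diff_ldistrib matrix_diff_rdistrib

text \<open>\<open>M Y M X = M X\<close> is a product of two symmetric matrices, so transposing
  swaps the factors and gives \<open>M X M Y = M Y\<close>. Likewise \<open>X M = Y M\<close>, and
  then \<open>X = X M X = Y M Y = Y\<close>.\<close>

lemma penrose_unique:
  fixes M X Y :: "real^'m^'m"
  assumes X: "M ** X ** M = M" "X ** M ** X = X"
      "transpose (M ** X) = M ** X" "transpose (X ** M) = X ** M"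
    and Y: "M ** Y ** M = M" "Y ** M ** Y = Y"
      "transpose (M ** Y) = M ** Y" "transpose (Y ** M) = Y ** M"
  shows "X = Y"
proof -
  have "M ** X = transpose ((M ** Y) ** (M ** X))"
    using X Y by (simp add: matrix_mul_assoc)
  also have "\<dots> = (M ** X) ** (M ** Y)"
    using X(3) Y(3) by (metis matrix_transpose_mul)
  also have "\<dots> = M ** Y" using X by (simp add: matrix_mul_assoc)
  finally have l: "M ** X = M ** Y" .
  have "X ** M = transpose ((X ** M) ** (Y ** M))"
    using X Y by (metis matrix_mul_assoc)
  also have "\<dots> = (Y ** M) ** (X ** M)"
    using X(4) Y(4) by (metis matrix_transpose_mul)
  also have "\<dots> = Y ** M" using X by (metis matrix_mul_assoc)
  finally have r: "X ** M = Y ** M" .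
  show ?thesis using X(2) Y(2) l r by (metis matrix_mul_assoc)
qed

lemma moore_penrose_eqI:
  fixes M X :: "real^'m^'m"
  assumes "M ** X ** M = M" "X ** M ** X = X"
    "transpose (M ** X) = M ** X" "transpose (X ** M) = X ** M"
  shows "moore_penrose M = X"
  unfolding moore_penrose_def
proof (rule the_equality)
  fix Y
  assume "M ** Y ** M = M \<and> Y ** M ** Y = Y \<and>
    transpose (M ** Y) = M ** Y \<and> transpose (Y ** M) = Y ** M"
  then show "Y = X" by (elim conjE) (rule penrose_unique[OF _ _ _ _ assms])
qed (intro conjI assms)

lemma moore_penrose_of_kernel_projection:
  fixes M P :: "real^'m^'m"
  assumes idem: "P ** P = P" and sym: "transpose P = P"
    and MP: "M ** P = 0" and PM: "P ** M = 0"
    and ker: "\<And>x. M *v x = 0 \<Longrightarrow> P *v x = x"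
  defines "X \<equiv> moore_penrose M"
  shows "M ** X = mat 1 - P" "X ** M = mat 1 - P" "P ** X = 0"
proof -
  \<comment> \<open>Applying \<open>P\<close> shows that \<open>P\<close> kills \<open>x\<close>;
    then \<open>M\<close> does too, and a kernel vector of \<open>M\<close> is its own
    projection.\<close>
  have "x = 0" if x: "(M + P) *v x = 0" for x
  proof -
    have "P ** (M + P) = P" by (simp add: matrix_add_ldistrib PM idem)
    then have Px: "P *v x = 0"
      using x by (metis matrix_vector_mul_assoc matrix_vector_mult_0_right)
    with x have "M *v x = 0" by (simp add: matrix_vector_mult_add_rdistrib)
    with ker Px show ?thesis by metis
  qed
  then have "invertible (M + P)"
    by (simp add: invertible_left_inverse matrix_left_invertible_ker)
  then obtain N where N: "(M + P) ** N = mat 1" "N ** (M + P) = mat 1"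
    unfolding invertible_def by auto
  have "P ** (M + P) = P" "(M + P) ** P = P"
    by (simp_all add: matrix_add_ldistrib matrix_add_rdistrib PM MP idem)
  then have PN: "P ** N = P" and NP: "N ** P = P"
    using N by (metis matrix_mul_assoc matrix_mul_rid, metis matrix_mul_assoc matrix_mul_lid)
  have MN: "M ** N = mat 1 - P" and NM: "N ** M = mat 1 - P"
    using N PN NP by (simp_all add: matrix_add_ldistrib matrix_add_rdistrib eq_diff_eq)
  let ?Y = "N - P"
  have MY: "M ** ?Y = mat 1 - P" and YM: "?Y ** M = mat 1 - P" and PY: "P ** ?Y = 0"
    using MN NM PN MP PM idem by (simp_all add: matrix_diff_distribs)
  have "transpose (mat 1 - P) = mat 1 - P"
    using sym by (simp add: vec_eq_iff transpose_def mat_def)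
  moreover have "?Y ** M ** ?Y = ?Y"
    unfolding YM by (simp add: matrix_diff_distribs PN idem)
  moreover have "M ** ?Y ** M = M" unfolding MY by (simp add: matrix_diff_distribs PM)
  ultimately have "X = ?Y"
    unfolding X_def by (intro moore_penrose_eqI) (simp_all add: MY YM)
  then show "M ** X = mat 1 - P" "X ** M = mat 1 - P" "P ** X = 0"
    using MY YM PY by simp_all
qed

section \<open>Block averaging\<close>

text \<open>The projection \<open>P\<close>, in Kronecker form \<open>(1/n) J\<close> tensor the
  identity of order \<open>k\<close>, with \<open>J\<close> the all-ones matrix.\<close>

definition block_avg :: "real^('v::finite \<times> 'k::finite)^('v \<times> 'k)" where
  "block_avg = (\<chi> p q. if snd p = snd q then 1 / real CARD('v) else 0)"

lemma sum_UNIV_prod: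
  fixes f :: "'v::finite \<times> 'k::finite \<Rightarrow> 'a::comm_monoid_add"
  shows "sum f UNIV = (\<Sum>i\<in>UNIV. \<Sum>a\<in>UNIV. f (i, a))"
  by (simp add: sum.cartesian_product flip: UNIV_Times_UNIV)

lemma mult_block_avg:
  fixes A :: "real^('v::finite \<times> 'k::finite)^('v \<times> 'k)"
  shows "(A ** block_avg) $ p $ (j, b) = (\<Sum>l\<in>UNIV. A $ p $ (l, b)) / real CARD('v)"
  by (simp add: matrix_matrix_mult_def block_avg_def sum_UNIV_prod if_distrib sum_divide_distrib
      cong: if_cong)

lemma block_avg_mult:
  fixes A :: "real^('v::finite \<times> 'k::finite)^('v \<times> 'k)"
  shows "(block_avg ** A) $ (i, a) $ q = (\<Sum>l\<in>UNIV. A $ (l, a) $ q) / real CARD('v)"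
  by (simp add: matrix_matrix_mult_def block_avg_def sum_UNIV_prod if_distrib sum_divide_distrib
      if_distribR cong: if_cong)

lemma block_avg_vec:
  fixes x :: "real^('v::finite \<times> 'k::finite)"
  shows "(block_avg *v x) $ (i, a) = (\<Sum>l\<in>UNIV. x $ (l, a)) / real CARD('v)"
  by (simp add: matrix_vector_mult_def block_avg_def sum_UNIV_prod if_distrib sum_divide_distrib
      if_distribR cong: if_cong)

lemma block_avg_idem: "block_avg ** block_avg = (block_avg :: real^('v::finite \<times> 'k::finite)^('v \<times> 'k))"
  by (auto simp: vec_eq_iff mult_block_avg) (simp add: block_avg_def)

lemma block_avg_sym: "transpose block_avg = (block_avg :: real^('v::finite \<times> 'k::finite)^('v \<times> 'k))"
  by (simp add: vec_eq_iff transpose_def block_avg_def eq_commute)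

text \<open>Isolates the dependence of the resistance matrix on the chosen inverse, which is
  linear.\<close>

definition resistance_of ::
  "real^('v::finite \<times> 'k::finite)^('v \<times> 'k) \<Rightarrow> real^('v \<times> 'k)^('v \<times> 'k)" where
  "resistance_of C = mat_of_blocks (\<lambda>i j.
     mat_block C i i + mat_block C j j - mat_block C i j - mat_block C j i)"

lemma resistance_of_nth:
  "resistance_of C $ (i, a) $ (j, b) =
    C $ (i, a) $ (i, b) + C $ (j, a) $ (j, b) - C $ (i, a) $ (j, b) - C $ (j, a) $ (i, b)"
  by (simp add: resistance_of_def mat_of_blocks_def mat_block_def)

lemma resistance_of_eqI:
  fixes C D :: "real^('v::finite \<times> 'k::finite)^('v \<times> 'k)"
  assumes "(mat 1 - block_avg) ** (C - D) ** (mat 1 - block_avg) = 0"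
  shows "resistance_of C = resistance_of D"
proof -
  let ?P = "block_avg :: real^('v \<times> 'k)^('v \<times> 'k)"
  define F where "F = C - D"
  have F: "F = F ** ?P + ?P ** (F - F ** ?P)"
    using assms unfolding F_def[symmetric]
    by (simp add: matrix_diff_distribs matrix_mul_assoc algebra_simps)
  \<comment> \<open>In \<open>F P\<close> an entry is independent of the column vertex, in
    \<open>P (F - F P)\<close> of the row vertex, so each summand contributes equally to both
    sides.\<close>
  have swap: "F $ (i, a) $ (i, b) + F $ (j, a) $ (j, b) = F $ (i, a) $ (j, b) + F $ (j, a) $ (i, b)"
    for i j a b
    by (subst (1 2 3 4) F) (simp add: mult_block_avg block_avg_mult)
  have "resistance_of F $ p $ q = 0" for p q
    by (cases p; cases q) (use swap[of "fst p" "snd p" "snd q" "fst q"] in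
        \<open>simp add: resistance_of_nth del: right_minus_eq\<close>)
  moreover have "resistance_of F $ p $ q = resistance_of C $ p $ q - resistance_of D $ p $ q" for p q
    by (cases p; cases q) (simp add: resistance_of_nth F_def)
  ultimately show ?thesis by (simp add: vec_eq_iff)
qed

lemma sum_resistance_of:
  fixes X :: "real^('v::finite \<times> 'k::finite)^('v \<times> 'k)"
  assumes "block_avg ** X = 0"
  shows "(\<Sum>i\<in>UNIV. \<Sum>j\<in>UNIV. mat_block (resistance_of X) i j) =
    (2 * real CARD('v)) *\<^sub>R (\<Sum>i\<in>UNIV. mat_block X i i)"
proof -
  have col: "(\<Sum>l\<in>UNIV. X $ (l, a) $ q) = 0" for a q
    \<comment> \<open>The row vertex is arbitrary: every block row of \<open>P X\<close> is the same
      average.\<close>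
    using block_avg_mult[of X undefined a q] assms by simp
  then have col': "(\<Sum>i\<in>UNIV. \<Sum>j\<in>UNIV. X $ (i, a) $ (j, b)) = 0" for a b
    by (subst sum.swap) simp
  show ?thesis
    by (simp add: vec_eq_iff mat_block_def resistance_of_nth sum.distrib sum_subtractf col col'
        algebra_simps flip: sum_distrib_left)
qed

section \<open>The kernel of the Laplacian\<close>

context matrix_weighted_graph
begin

text \<open>Extending the inverse weights by zero off the edges lets all sums run over every vertex;
  irreflexivity makes the diagonal zero.\<close>

definition conductance :: "'v \<Rightarrow> 'v \<Rightarrow> real^'k^'k" where
  "conductance i j = (if E i j then matrix_inv (W i j) else 0)"

lemma conductance_sym: "conductance i j = conductance j i"
  unfolding conductance_def using adj_sym weight_sym by metis

lemma conductance_inner_nonneg: "0 \<le> x \<bullet> (conductance i j *v x)"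
  by (cases "x = 0") (auto simp: conductance_def intro!: less_imp_le
      pos_def_matrix_inv_inner weight_pos_def)

lemma laplacian_nth:
  "laplacian E W $ (i, a) $ (j, b) =
    (if i = j then \<Sum>l\<in>UNIV. conductance i l $ a $ b else 0) - conductance i j $ a $ b"
proof -
  have "(\<Sum>l | E i l. matrix_inv (W i l)) = (\<Sum>l\<in>UNIV. conductance i l)"
    unfolding conductance_def by (simp add: sum.If_cases)
  then have "(\<Sum>l | E i l. matrix_inv (W i l) $ a $ b) = (\<Sum>l\<in>UNIV. conductance i l $ a $ b)"
    by (metis (no_types) sum_component)
  then show ?thesis
    by (auto simp: laplacian_def mat_of_blocks_def adj_irrefl) (auto simp: conductance_def adj_irrefl)
qed

lemma laplacian_block_avg: "laplacian E W ** block_avg = 0"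
  by (auto simp: vec_eq_iff mult_block_avg laplacian_nth sum_subtractf)

lemma block_avg_laplacian: "block_avg ** laplacian E W = 0"
  by (auto simp: vec_eq_iff block_avg_mult laplacian_nth sum_subtractf conductance_sym
      cong: if_cong)

text \<open>Distributing the diagonal block over its summands pairs each with an off-diagonal block,
  so \<open>L x\<close> becomes a net flow at each vertex.\<close>

lemma laplacian_mult_vec:
  "(\<chi> a. (laplacian E W *v x) $ (i, a)) =
    (\<Sum>j\<in>UNIV. conductance i j *v ((\<chi> a. x $ (i, a)) - (\<chi> a. x $ (j, a))))"
proof -
  have "(\<Sum>j\<in>UNIV. \<Sum>b\<in>UNIV. (if i = j then \<Sum>l\<in>UNIV. conductance i l $ a $ b else 0) * x $ (j, b))
    = (\<Sum>j\<in>UNIV. \<Sum>b\<in>UNIV. conductance i j $ a $ b * x $ (i, b))" for a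
  proof -
    have "(\<Sum>j\<in>UNIV. \<Sum>b\<in>UNIV. (if i = j then \<Sum>l\<in>UNIV. conductance i l $ a $ b else 0) * x $ (j, b))
      = (\<Sum>b\<in>UNIV. (\<Sum>l\<in>UNIV. conductance i l $ a $ b) * x $ (i, b))"
      by (subst sum.swap) (simp add: if_distribR if_distrib cong: if_cong)
    also have "\<dots> = (\<Sum>j\<in>UNIV. \<Sum>b\<in>UNIV. conductance i j $ a $ b * x $ (i, b))"
      by (subst sum.swap) (simp add: sum_distrib_right)
    finally show ?thesis .
  qed
  then show ?thesis
    by (simp add: vec_eq_iff matrix_vector_mult_def sum_UNIV_prod laplacian_nth left_diff_distrib
        right_diff_distrib sum_subtractf)
qed

text \<open>An energy argument: the sum of all \<open>?q i j\<close> is twice the quadratic form of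
  \<open>L\<close> at \<open>x\<close>, hence zero. Its terms are nonnegative, so each vanishes;
  definiteness equates \<open>y\<close> across edges and connectedness across all vertices.\<close>

lemma laplacian_kernel:
  assumes "laplacian E W *v x = 0"
  shows "block_avg *v x = x"
proof -
  define y where "y i = (\<chi> a. x $ (i, a))" for i
  let ?q = "\<lambda>i j. (y i - y j) \<bullet> (conductance i j *v (y i - y j))"
  have row: "(\<Sum>j\<in>UNIV. conductance i j *v (y i - y j)) = 0" for i
    using laplacian_mult_vec[of x i] assms unfolding y_def by (simp add: vec_eq_iff)
  have flow: "(\<Sum>i\<in>UNIV. \<Sum>j\<in>UNIV. y i \<bullet> (conductance i j *v (y i - y j))) = 0"
    by (simp add: row flip: inner_sum_right)
  have neg: "conductance j i *v (y j - y i) = - (conductance i j *v (y i - y j))" for i j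
    by (simp add: conductance_sym[of j i] matrix_vector_mult_diff_distrib)
  \<comment> \<open>The flow along an edge is antisymmetric in its ends, so exchanging the summation
    indices changes the sign.\<close>
  have "(\<Sum>i\<in>UNIV. \<Sum>j\<in>UNIV. y j \<bullet> (conductance i j *v (y i - y j))) =
      - (\<Sum>i\<in>UNIV. \<Sum>j\<in>UNIV. y i \<bullet> (conductance i j *v (y i - y j)))"
    by (subst sum.swap, subst neg) (simp add: sum_negf)
  with flow have "(\<Sum>i\<in>UNIV. \<Sum>j\<in>UNIV. ?q i j) = 0"
    by (simp add: inner_diff_left sum_subtractf)
  then have q0: "?q i j = 0" for i j
    by (simp add: sum_nonneg_eq_0_iff sum_nonneg conductance_inner_nonneg)
  have adj: "y i = y j" if "E i j" for i j
    using q0[of i j] pos_def_matrix_inv_inner[OF weight_pos_def[OF that], of "y i - y j"] that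
    by (auto simp: conductance_def)
  have "y i = y j" for i j
    using connected[of i j] by (induction rule: rtranclp_induct) (auto dest: adj)
  then have "x $ (i, a) = x $ (j, a)" for i j a
    unfolding y_def by (metis vec_lambda_beta)
  then have avg: "(\<Sum>l\<in>UNIV. x $ (l, a)) = (\<Sum>l\<in>(UNIV :: 'v set). x $ (i, a))" for i a
    by (intro sum.cong) auto
  have "(block_avg *v x) $ (i, a) = x $ (i, a)" for i a
    unfolding block_avg_vec avg[of a i] by simp
  then show ?thesis by (simp add: vec_eq_iff)
qed

section \<open>Independence of the resistance matrix from the (1)-inverse\<close>

lemma laplacian_moore_penrose:
  "laplacian E W ** moore_penrose (laplacian E W) = mat 1 - block_avg"
  "moore_penrose (laplacian E W) ** laplacian E W = mat 1 - block_avg"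
  "block_avg ** moore_penrose (laplacian E W) = 0"
  by (rule moore_penrose_of_kernel_projection block_avg_idem block_avg_sym laplacian_block_avg
      block_avg_laplacian laplacian_kernel | assumption)+

lemma one_inverse_moore_penrose_laplacian:
  "one_inverse (laplacian E W) (moore_penrose (laplacian E W))"
  by (simp add: one_inverse_def laplacian_moore_penrose block_avg_laplacian matrix_diff_distribs)

lemma resistance_of_one_inverse:
  assumes "one_inverse (laplacian E W) C"
  shows "resistance_of C = resistance_of (moore_penrose (laplacian E W))"
proof (rule resistance_of_eqI)
  let ?L = "laplacian E W" and ?X = "moore_penrose (laplacian E W)"
  have "?L ** (C - ?X) ** ?L = 0"
    using assms one_inverse_moore_penrose_laplacian by (simp add: one_inverse_def matrix_diff_distribs)
  \<comment> \<open>Sandwiching between copies of \<open>?X\<close> turns the outer Laplacians into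
    the complementary projection.\<close>
  then have "?X ** (?L ** (C - ?X) ** ?L) ** ?X = 0" by simp
  then have "(?X ** ?L) ** (C - ?X) ** (?L ** ?X) = 0" by (simp add: matrix_mul_assoc)
  then show "(mat 1 - block_avg) ** (C - ?X) ** (mat 1 - block_avg) = 0"
    unfolding laplacian_moore_penrose .
qed

lemma resistance_matrix_eq:
  "resistance_matrix E W = resistance_of (moore_penrose (laplacian E W))"
  unfolding resistance_matrix_def resistance_of_def[symmetric]
proof (rule the_equality)
  show "\<exists>C. one_inverse (laplacian E W) C \<and>
      resistance_of (moore_penrose (laplacian E W)) = resistance_of C"
    using one_inverse_moore_penrose_laplacian by blast
qed (elim exE conjE, simp only: resistance_of_one_inverse)

end

theorem theorem3p4:
  fixes E :: "'v::finite \<Rightarrow> 'v \<Rightarrow> bool"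
    and W :: "'v \<Rightarrow> 'v \<Rightarrow> real^'k^'k"
  assumes "matrix_weighted_graph E W"
  shows "kirchhoff_index E W =
    real CARD('v) *\<^sub>R (\<Sum>i\<in>UNIV. mat_block (moore_penrose (laplacian E W)) i i)"
proof -
  interpret matrix_weighted_graph E W by fact
  show ?thesis
    unfolding kirchhoff_index_def resistance_matrix_eq
    \<comment> \<open>The factor \<open>1/2\<close> cancels the 2 that comes from the two diagonal
      blocks in each resistance.\<close>
    by (simp add: sum_resistance_of laplacian_moore_penrose)
qed

end
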